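(* Let $A \in M_n$ with $n \ge 4$. Then $\Lambda_2(A) \neq \emptyset$.
   Context: $M_n$ denotes the algebra of $n \times n$ complex matrices. For $A \in M_n$ and a positive integer $k$, the rank-$k$ numerical range of $A$ is $$\Lambda_k(A) = \{\lambda \in \mathbb{C} : X^*AX = \lambda I_k \text{ for some } n \times k \text{ complex matrix } X \text{ with } X^*X = I_k\},$$ where $X^*$ is the conjugate transpose of $X$ and $I_k$ is the $k \times k$ identity matrix. The claim concerns the case $k = 2$. *)

theory Defs
  imports "Jordan_Normal_Form.Schur_Decomposition"
begin

(* mat_adjoint is the conjugate transpose: *)
lemma mat_adjoint_complex:
  fixes A :: "complex mat"
  shows "mat_adjoint A = mat (dim_col A) (dim_row A) (\<lambda>(i, j). cnj (A $$ (j, i)))"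
  by (rule eq_matI) (auto simp: mat_adjoint_def mat_of_rows_def)

(* Intended for square A and positive k. *)
definition rank_numerical_range :: "nat \<Rightarrow> complex mat \<Rightarrow> complex set" where
  "rank_numerical_range k A =
    {c. \<exists>X \<in> carrier_mat (dim_row A) k.
          mat_adjoint X * X = 1\<^sub>m k \<and>
          mat_adjoint X * A * X = c \<cdot>\<^sub>m 1\<^sub>m k}"

end

theory Submission
  imports Defs "HOL-Analysis.Analysis"
begin

text \<open>
The claim amounts to finding a number \<open>l\<close> such that the form of \<open>B = A - l\<close> vanishes identically on some
plane: an orthonormal basis of such a plane gives the columns of \<open>X\<close>.  It suffices to treat a
principal submatrix of size 4.

\<^emph>\<open>Choice of \<open>l\<close>.\<close>  For every unit vector \<open>u\<close> let \<open>W u\<close> be the numerical range of the compression of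
\<open>A\<close> to the hyperplane perpendicular to \<open>u\<close>.  It is compact, and convex by the Toeplitz--Hausdorff
theorem (\<open>convex_numrange\<close>).  In dimension 4 any three hyperplanes share a unit vector, so any three
of these sets meet, and by Helly's theorem and compactness they all meet
(\<open>hyperplane_core_nonempty\<close>).  Let \<open>l\<close> be a boundary point of the intersection.  Because \<open>l\<close> belongs to the
intersection, \<open>B\<close> has an isotropic vector in every hyperplane.  Because \<open>l\<close> is a limit of
points outside, a limit of separating lines shows that the Hermitian part of some nonzero multiple \<open>c B\<close>
is positive semidefinite on some hyperplane (\<open>boundary_point_semidefinite\<close>).

\<^emph>\<open>A first isotropic vector.\<close>  That hyperplane may be taken to be the complement of an eigenvector for
the least eigenvalue.  An isotropic vector \<open>x\<close> of \<open>B\<close> in it is a null vector of a semidefinite form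
on an invariant subspace, and so it lies in the kernel of the Hermitian part of \<open>c B\<close>
(\<open>isotropic_kernel_vector\<close>).

\<^emph>\<open>A second one.\<close>  For a vector \<open>x\<close> in that kernel, two-sided orthogonality to \<open>x\<close> with respect to \<open>B\<close>
is only one linear equation instead of two.  This leaves enough room for an
isotropic vector \<open>y\<close>: otherwise a suitable Hermitian part would be semidefinite on a hyperplane and
would have no isotropic kernel vector, contradicting the previous step (\<open>isotropic_plane\<close>).
\<close>

(* This symbol denotes below the components of vectors with a finite index type. *)
no_notation vec_index (infixl "$" 100)

section \<open>The complex inner product on coordinate space\<close>

definition cinner :: "complex^'n \<Rightarrow> complex^'n \<Rightarrow> complex" where
  "cinner x y = (\<Sum>i\<in>UNIV. cnj (x $ i) * y $ i)"

definition quad :: "complex^'n^'n \<Rightarrow> complex^'n \<Rightarrow> complex" where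
  "quad B x = cinner x (B *v x)"

text \<open>
Every subspace that occurs below is the orthogonal complement of at most three vectors.  Describing
it by those vectors makes its codimension bounded by construction.
\<close>

definition cperp :: "(complex^'n) set \<Rightarrow> (complex^'n) set" where
  "cperp U = {w. \<forall>u\<in>U. cinner u w = 0}"

lemma cinner_add_right: "cinner x (y + z) = cinner x y + cinner x z"
  by (simp add: cinner_def algebra_simps sum.distrib)

lemma cinner_add_left: "cinner (x + y) z = cinner x z + cinner y z"
  by (simp add: cinner_def algebra_simps sum.distrib)

lemma cinner_diff_right: "cinner x (y - z) = cinner x y - cinner x z"
  by (simp add: cinner_def algebra_simps sum_subtractf)

lemma cinner_scale_right: "cinner x (c *s y) = c * cinner x y"
  by (simp add: cinner_def algebra_simps sum_distrib_left)

lemma cinner_scale_left: "cinner (c *s x) y = cnj c * cinner x y"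
  by (simp add: cinner_def algebra_simps sum_distrib_left)

lemma cinner_zero_right: "cinner x 0 = 0"
  by (simp add: cinner_def)

lemma cinner_zero_left: "cinner 0 x = 0"
  by (simp add: cinner_def)

lemma cnj_cinner: "cnj (cinner x y) = cinner y x"
  by (simp add: cinner_def cnj_sum mult.commute)

lemma cinner_commute_zero: "cinner x y = 0 \<longleftrightarrow> cinner y x = 0"
  by (metis cnj_cinner complex_cnj_zero)

lemmas cinner_simps = cinner_add_right cinner_add_left cinner_diff_right
  cinner_scale_right cinner_scale_left cinner_zero_left cinner_zero_right

lemma Re_cinner: "Re (cinner x y) = inner x y"
  by (simp add: cinner_def inner_vec_def inner_complex_def)

lemma cinner_self: "cinner x x = of_real ((norm x)\<^sup>2)"
proof -
  have "Im (cinner x x) = 0"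
    using arg_cong[OF cnj_cinner[of x x], of Im] by simp
  moreover have "Re (cinner x x) = (norm x)\<^sup>2"
    by (simp add: Re_cinner power2_norm_eq_inner)
  ultimately show ?thesis by (simp add: complex_eq_iff)
qed

lemma scaleR_eq_scale: "r *\<^sub>R x = complex_of_real r *s x"
  by (simp add: vec_eq_iff scaleR_conv_of_real[where 'a = complex])

lemma continuous_on_cinner [continuous_intros]:
  "continuous_on S f \<Longrightarrow> continuous_on S g \<Longrightarrow> continuous_on S (\<lambda>x. cinner (f x) (g x))"
  unfolding cinner_def by (intro continuous_intros)

lemma continuous_on_quad: "continuous_on S (quad B)"
proof -
  have "continuous_on S (\<lambda>x. B *v x)"
    by (simp add: matrix_vector_mult_def) (intro continuous_intros)
  then show ?thesis
    unfolding quad_def by (intro continuous_intros)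
qed

lemma quad_zero: "quad B 0 = 0"
  by (simp add: quad_def cinner_simps)

lemma quad_scale: "quad B (c *s x) = of_real ((cmod c)\<^sup>2) * quad B x"
proof -
  have "quad B (c *s x) = (c * cnj c) * quad B x"
    by (simp add: quad_def vector_scalar_commute cinner_simps)
  then show ?thesis by (simp only: complex_norm_square)
qed

lemma Re_of_real_times: "Re (of_real r * z) = r * Re z"
  by simp

lemma cinner_diff_mat:
  "cinner x ((B - Finite_Cartesian_Product.mat l) *v y) = cinner x (B *v y) - l * cinner x y"
proof -
  have "Finite_Cartesian_Product.mat l *v y = l *s y"
    by (simp add: vec_eq_iff matrix_vector_mult_def Finite_Cartesian_Product.mat_def
        if_distrib[of "\<lambda>a. a * _"] cong: if_cong)
  then show ?thesis
    by (simp add: matrix_vector_mult_diff_rdistrib cinner_simps)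
qed

lemma quad_diff_mat:
  "quad (B - Finite_Cartesian_Product.mat l) x = quad B x - l * of_real ((norm x)\<^sup>2)"
  by (simp add: quad_def cinner_diff_mat cinner_self)

lemma cperp_add: "x \<in> cperp U \<Longrightarrow> y \<in> cperp U \<Longrightarrow> x + y \<in> cperp U"
  by (simp add: cperp_def cinner_simps)

lemma cperp_scale: "x \<in> cperp U \<Longrightarrow> c *s x \<in> cperp U"
  by (simp add: cperp_def cinner_simps)

lemma closed_cperp: "closed (cperp U)"
proof -
  have "cperp U = (\<Inter>u\<in>U. {w. cinner u w = 0})"
    by (auto simp: cperp_def)
  moreover have "closed {w. cinner u w = 0}" for u :: "complex^'n"
    by (intro closed_Collect_eq continuous_intros)
  ultimately show ?thesis by auto
qed

lemma normalize_in_cperp: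
  assumes "w \<in> cperp U" "w \<noteq> 0"
  obtains v where "v \<in> cperp U" "norm v = 1" "quad B w = of_real ((norm w)\<^sup>2) * quad B v"
proof
  let ?v = "of_real (1 / norm w) *s w"
  show "?v \<in> cperp U" using assms by (simp add: cperp_scale)
  have "?v = (1 / norm w) *\<^sub>R w" by (simp only: scaleR_eq_scale)
  then show "norm ?v = 1" using assms by simp
  show "quad B w = of_real ((norm w)\<^sup>2) * quad B ?v"
    using assms(2) by (subst quad_scale) (simp add: norm_divide power_divide)
qed

text \<open>
Each vector \<^term>\<open>u\<close> imposes one complex linear equation.  Over the reals this is
orthogonality to the two vectors \<^term>\<open>u\<close> and \<^term>\<open>\<i> *s u\<close>, so the dimension
count for real Euclidean spaces applies.
\<close>

lemma exists_unit_cperp: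
  fixes U :: "(complex^'n) set"
  assumes "finite U" "card U < CARD('n)"
  obtains w where "w \<in> cperp U" "norm w = 1"
proof -
  let ?S = "U \<union> (\<lambda>u. \<i> *s u) ` U"
  have "dim ?S \<le> card ?S" using assms by (intro dim_le_card') auto
  also have "\<dots> \<le> card U + card ((\<lambda>u. \<i> *s u) ` U)" by (rule card_Un_le)
  also have "\<dots> \<le> 2 * card U" using card_image_le[OF assms(1), of "\<lambda>u. \<i> *s u"] by simp
  also have "\<dots> < DIM(complex^'n)" using assms by simp
  finally obtain w where w: "w \<noteq> 0" "\<And>y. y \<in> span ?S \<Longrightarrow> orthogonal w y"
    using orthogonal_to_subspace_exists by blast
  have "cinner u w = 0" if "u \<in> U" for u
  proof -
    have "inner u w = 0" "inner (\<i> *s u) w = 0"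
      using w(2)[of u] w(2)[of "\<i> *s u"] that
      by (auto simp: orthogonal_def inner_commute intro: span_base)
    then have "Re (cinner u w) = 0" "Re (cinner (\<i> *s u) w) = 0"
      by (simp_all only: Re_cinner)
    then show ?thesis by (simp add: cinner_simps complex_eq_iff)
  qed
  then have "w \<in> cperp U" by (simp add: cperp_def)
  then show ?thesis using normalize_in_cperp[OF _ w(1)] that by metis
qed

section \<open>Numerical ranges of compressions are convex\<close>

definition numrange :: "complex^'n^'n \<Rightarrow> (complex^'n) set \<Rightarrow> complex set" where
  "numrange B U = quad B ` (cperp U \<inter> sphere 0 1)"

lemma numrangeI: "w \<in> cperp U \<Longrightarrow> norm w = 1 \<Longrightarrow> quad B w \<in> numrange B U"
  by (simp add: numrange_def)

lemma compact_numrange: "compact (numrange B U)"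
  unfolding numrange_def
  by (intro compact_continuous_image continuous_on_quad closed_Int_compact closed_cperp) auto

lemma quad_add_scale:
  "quad B (a *s x + b *s y) = of_real ((cmod a)\<^sup>2) * quad B x + of_real ((cmod b)\<^sup>2) * quad B y
     + (cnj a * b * cinner x (B *v y) + cnj b * a * cinner y (B *v x))"
proof -
  have "quad B (a *s x + b *s y) = (a * cnj a) * quad B x + (b * cnj b) * quad B y
     + (cnj a * b * cinner x (B *v y) + cnj b * a * cinner y (B *v x))"
    by (simp add: quad_def matrix_vector_right_distrib vector_scalar_commute cinner_simps algebra_simps)
  then show ?thesis by (simp only: complex_norm_square)
qed

text \<open>
The core of the Toeplitz--Hausdorff theorem.  After dividing by \<^term>\<open>d\<close> the two values are
real of opposite sign.  A unimodular factor on \<^term>\<open>y\<close> can be chosen so that the cross term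
becomes real as well; along the segment from \<^term>\<open>y\<close> to \<^term>\<open>x\<close> the form is then a real
continuous function that changes sign.
\<close>

lemma isotropic_between_opposite_values:
  assumes U: "x \<in> cperp U" "y \<in> cperp U"
    and x: "quad B x = of_real s * d" and y: "quad B y = - of_real r * d"
    and pos: "s > 0" "r > 0" "d \<noteq> 0"
  obtains v where "v \<in> cperp U" "v \<noteq> 0" "quad B v = 0"
proof -
  define \<alpha> where "\<alpha> = cinner x (B *v y) / d"
  define \<beta> where "\<beta> = cinner y (B *v x) / d"
  define \<gamma> where "\<gamma> = \<alpha> - cnj \<beta>"
  define \<zeta> where "\<zeta> = (if \<gamma> = 0 then 1 else cnj \<gamma> / of_real (cmod \<gamma>))"
  have z1: "cmod \<zeta> = 1" by (simp add: \<zeta>_def norm_divide)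
  have "\<zeta> * \<gamma> = of_real (cmod \<gamma>)"
    using complex_norm_square[of \<gamma>] by (simp add: \<zeta>_def field_simps power2_eq_square)
  then have "Im (\<zeta> * \<gamma>) = 0" by simp
  then have im: "Im (\<zeta> * \<alpha> + cnj \<zeta> * \<beta>) = 0"
    by (simp add: \<gamma>_def algebra_simps)
  \<comment> \<open>The segment from the rotated second vector (at 0) to the first one (at 1).\<close>
  define v where "v t = of_real t *s x + (of_real (1 - t) * \<zeta>) *s y" for t :: real
  define f where "f t = t\<^sup>2 * s - (1 - t)\<^sup>2 * r + t * (1 - t) * Re (\<zeta> * \<alpha> + cnj \<zeta> * \<beta>)" for t
  have q: "quad B (v t) = of_real (f t) * d" for t
  proof -
    have "quad B (v t) = of_real (t\<^sup>2) * (of_real s * d) - of_real ((1-t)\<^sup>2) * (of_real r * d)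
        + of_real (t * (1 - t)) * ((\<zeta> * \<alpha> + cnj \<zeta> * \<beta>) * d)"
      unfolding v_def quad_add_scale x y using pos(3)
      by (simp add: norm_mult z1 \<alpha>_def \<beta>_def algebra_simps power_mult_distrib del: of_real_diff of_real_power)
         (simp add: algebra_simps)
    moreover have "\<zeta> * \<alpha> + cnj \<zeta> * \<beta> = of_real (Re (\<zeta> * \<alpha> + cnj \<zeta> * \<beta>))"
      using im by (simp add: complex_eq_iff)
    ultimately have "quad B (v t) = of_real (t\<^sup>2) * (of_real s * d) - of_real ((1-t)\<^sup>2) * (of_real r * d)
        + of_real (t * (1 - t)) * (of_real (Re (\<zeta> * \<alpha> + cnj \<zeta> * \<beta>)) * d)"
      by metis
    then show ?thesis by (simp add: f_def algebra_simps)
  qed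
  have "f 0 \<le> 0" "0 \<le> f 1" using pos by (auto simp: f_def)
  moreover have "continuous_on {0..1} f"
    unfolding f_def by (intro continuous_intros)
  ultimately obtain t where t: "f t = 0" using IVT'[of f 0 0 1] by auto
  show ?thesis
  proof
    show "v t \<in> cperp U" unfolding v_def by (intro cperp_add cperp_scale U)
    show "quad B (v t) = 0" by (simp add: q t)
    \<comment> \<open>Otherwise multiples of the two vectors would share a value that is both a nonnegative and a
        nonpositive multiple of d, forcing both coefficients to vanish; but t and 1 - t do not.\<close>
    show "v t \<noteq> 0"
    proof
      assume "v t = 0"
      then have "of_real t *s x = (- (of_real (1 - t) * \<zeta>)) *s y"
        by (simp add: v_def eq_neg_iff_add_eq_0 vector_smult_lneg)
      then have "quad B (of_real t *s x) = quad B ((- (of_real (1 - t) * \<zeta>)) *s y)" by simp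
      then have "of_real (t\<^sup>2) * (of_real s * d) = of_real ((1-t)\<^sup>2) * (- of_real r * d)"
        unfolding quad_scale x y
        by (simp add: norm_mult z1 power_mult_distrib del: of_real_diff of_real_power)
      then have "of_real (t\<^sup>2 * s + (1 - t)\<^sup>2 * r) * d = 0"
        by (simp add: algebra_simps)
      then have "t\<^sup>2 * s + (1 - t)\<^sup>2 * r = 0" using pos(3) by (simp del: of_real_add of_real_mult)
      moreover have "t\<^sup>2 * s \<ge> 0" "(1 - t)\<^sup>2 * r \<ge> 0" using pos by auto
      ultimately have "t\<^sup>2 * s = 0" "(1 - t)\<^sup>2 * r = 0" by linarith+
      then show False using pos by auto
    qed
  qed
qed

lemma quad_eq_if_isotropic_diff:
  assumes "v \<in> cperp U" "v \<noteq> 0" "quad (B - Finite_Cartesian_Product.mat p) v = 0"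
  shows "p \<in> numrange B U"
proof -
  obtain w where w: "w \<in> cperp U" "norm w = 1" "quad B v = of_real ((norm v)\<^sup>2) * quad B w"
    using normalize_in_cperp[OF assms(1,2)] by metis
  then have "quad B w = p"
    using assms by (simp add: quad_diff_mat)
  then show ?thesis
    using numrangeI[OF w(1,2)] by metis
qed

text \<open>
The Toeplitz--Hausdorff theorem, for the compression to a subspace.
\<close>

theorem convex_numrange: "convex (numrange B U)"
  unfolding convex_alt
proof (intro ballI allI impI)
  fix a b :: complex and t :: real
  assume ab: "a \<in> numrange B U" "b \<in> numrange B U" and t: "0 \<le> t \<and> t \<le> 1"
  let ?p = "(1 - t) *\<^sub>R a + t *\<^sub>R b"
  obtain x y where x: "x \<in> cperp U" "norm x = 1" "quad B x = a"
    and y: "y \<in> cperp U" "norm y = 1" "quad B y = b"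
    using ab by (auto simp: numrange_def)
  show "?p \<in> numrange B U"
  proof (cases "a = b \<or> t = 0 \<or> t = 1")
    case True
    then show ?thesis using ab by (auto simp: algebra_simps)
  next
    case False
    \<comment> \<open>Shifting by the intermediate point makes the two end points opposite multiples of
        their difference.\<close>
    let ?B = "B - Finite_Cartesian_Product.mat ?p"
    have "quad ?B x = of_real t * (a - b)" "quad ?B y = - of_real (1 - t) * (a - b)"
      by (simp_all add: quad_diff_mat x y scaleR_conv_of_real algebra_simps)
    then obtain v where "v \<in> cperp U" "v \<noteq> 0" "quad ?B v = 0"
      using isotropic_between_opposite_values[OF x(1) y(1), of ?B t "a - b" "1 - t"] False t by auto
    then show ?thesis by (rule quad_eq_if_isotropic_diff)
  qed
qed

section \<open>The common part of the numerical ranges on hyperplanes\<close>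

text \<open>
Three hyperplanes of a space of dimension at least 4 share a unit vector, and the value of the form
at that vector lies in all three numerical ranges.  Helly's theorem in the complex plane needs no more
than that.
\<close>

lemma finite_numranges_meet:
  fixes A :: "complex^'n^'n"
  assumes n: "CARD('n) \<ge> 4"
    and F: "finite F" "F \<subseteq> (\<lambda>u. numrange A {u}) ` sphere 0 1"
  shows "\<Inter>F \<noteq> {}"
proof -
  have small: "\<Inter>T \<noteq> {}" if T: "T \<subseteq> F" "card T \<le> 3" for T
  proof -
    have "T \<subseteq> (\<lambda>u. numrange A {u}) ` sphere 0 1" using T F by blast
    then obtain U where U: "inj_on (\<lambda>u. numrange A {u}) U" "T = (\<lambda>u. numrange A {u}) ` U"
      unfolding subset_image_inj by blast
    have "finite U"
      using finite_imageD[OF _ U(1)] U(2) finite_subset[OF T(1) F(1)] by auto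
    moreover have "card U < CARD('n)"
      using card_image[OF U(1)] U(2) T(2) n by simp
    ultimately obtain w where w: "w \<in> cperp U" "norm w = 1"
      by (rule exists_unit_cperp)
    have "quad A w \<in> numrange A {u}" if "u \<in> U" for u
      using w that unfolding numrange_def cperp_def by (intro imageI) auto
    then show ?thesis using U(2) by auto
  qed
  show ?thesis
  proof (cases "card F \<le> 3")
    case True
    then show ?thesis using small by blast
  next
    case False
    show ?thesis
    proof (rule Helly)
      show "DIM(complex) + 1 \<le> card F" using False by simp
      show "\<forall>s\<in>F. convex s" using F(2) convex_numrange by blast
      show "\<Inter>t \<noteq> {}" if "t \<subseteq> F" "card t = DIM(complex) + 1" for t
        using small[of t] that by simp
    qed
  qed
qed

text \<open>
A point \<^term>\<open>l\<close> lies in this set iff no real part of a unimodular multiple of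
\<^term>\<open>A - Finite_Cartesian_Product.mat l\<close> is positive definite on a hyperplane, that is, iff the second
smallest eigenvalue of each of these Hermitian matrices is at most 0.  So it is the
intersection of half planes that is known to describe the rank-2 numerical range.  Its boundary points
are the ones to aim for, since there one of these Hermitian matrices is singular.
\<close>

definition hyperplane_core :: "complex^'n^'n \<Rightarrow> complex set" where
  "hyperplane_core A = (\<Inter>u\<in>sphere 0 1. numrange A {u})"

lemma unit_vector_exists: "\<exists>u::complex^'n. norm u = 1"
  by (rule exI[of _ "axis undefined 1"]) simp

lemma compact_hyperplane_core: "compact (hyperplane_core A)"
proof -
  obtain u :: "complex^'n" where "norm u = 1" using unit_vector_exists by blast
  then show ?thesis
    unfolding hyperplane_core_def
    by (intro compact_Inter) (auto intro: compact_numrange)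
qed

lemma hyperplane_core_nonempty:
  fixes A :: "complex^'n^'n"
  assumes "CARD('n) \<ge> 4"
  shows "hyperplane_core A \<noteq> {}"
proof -
  obtain u :: "complex^'n" where u: "norm u = 1" using unit_vector_exists by blast
  have "numrange A {u} \<inter> \<Inter>((\<lambda>u. numrange A {u}) ` sphere 0 1) \<noteq> {}"
  proof (rule compact_imp_fip)
    fix F assume F: "finite F" "F \<subseteq> (\<lambda>u. numrange A {u}) ` sphere 0 1"
    have "\<Inter>(insert (numrange A {u}) F) \<noteq> {}"
      by (rule finite_numranges_meet[OF assms]) (use F u in auto)
    then show "numrange A {u} \<inter> \<Inter>F \<noteq> {}" by simp
  qed (auto intro: compact_numrange compact_imp_closed)
  then show ?thesis by (auto simp: hyperplane_core_def)
qed

lemma tendsto_cinner [tendsto_intros]: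
  "(f \<longlongrightarrow> a) F \<Longrightarrow> (g \<longlongrightarrow> b) F \<Longrightarrow> ((\<lambda>x. cinner (f x) (g x)) \<longlongrightarrow> cinner a b) F"
  unfolding cinner_def by (intro tendsto_intros)

lemma tendsto_quad [tendsto_intros]:
  "(f \<longlongrightarrow> a) F \<Longrightarrow> ((\<lambda>x. quad B (f x)) \<longlongrightarrow> quad B a) F"
  using continuous_on_tendsto_compose[OF continuous_on_quad[of UNIV B]] by simp

lemma tendsto_scale [tendsto_intros]:
  "(f \<longlongrightarrow> c) F \<Longrightarrow> (g \<longlongrightarrow> x) F \<Longrightarrow> ((\<lambda>t. f t *s g t) \<longlongrightarrow> c *s x) F"
  for x :: "complex^'n"
  unfolding vector_scalar_mult_def by (intro tendsto_intros)

text \<open>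
Since the numerical range on a hyperplane is compact and convex, a point outside of it is cut off by
a line.  The inequality is stated in homogeneous form and with a normalised direction so that it
survives passing to a limit.
\<close>

lemma separating_direction:
  fixes A :: "complex^'n^'n"
  assumes "z \<notin> hyperplane_core A" "CARD('n) \<ge> 2"
  obtains u c where "norm u = 1" "cmod c = 1"
    "\<And>w. w \<in> cperp {u} \<Longrightarrow> 0 \<le> Re (c * (quad A w - z * of_real ((norm w)\<^sup>2)))"
proof -
  obtain u where u: "norm u = 1" "z \<notin> numrange A {u}"
    using assms by (auto simp: hyperplane_core_def)
  obtain a b where ab: "inner a z < b" "\<And>x. x \<in> numrange A {u} \<Longrightarrow> b < inner a x"
    using separating_hyperplane_closed_point[OF convex_numrange compact_imp_closed[OF compact_numrange] u(2)]
    by blast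
  obtain v where "v \<in> cperp {u}" "norm v = 1"
    by (rule exists_unit_cperp[of "{u}"]) (use assms in auto)
  then have "quad A v \<in> numrange A {u}" by (rule numrangeI)
  then have "a \<noteq> 0" using ab(1) ab(2)[of "quad A v"] by auto
  define c where "c = cnj a / of_real (cmod a)"
  have c: "Re (c * y) = inner a y / cmod a" for y
    by (simp add: c_def inner_complex_def diff_divide_distrib add_divide_distrib Re_divide_of_real)
  show ?thesis
  proof
    show "norm u = 1" by fact
    show "cmod c = 1" using \<open>a \<noteq> 0\<close> by (simp add: c_def norm_divide)
    fix w assume w: "w \<in> cperp {u}"
    show "0 \<le> Re (c * (quad A w - z * of_real ((norm w)\<^sup>2)))"
    proof (cases "w = 0")
      case True
      then show ?thesis by (simp add: quad_zero)
    next
      case False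
      obtain v where v: "v \<in> cperp {u}" "norm v = 1" "quad A w = of_real ((norm w)\<^sup>2) * quad A v"
        using normalize_in_cperp[OF w False] by metis
      then have "c * (quad A w - z * of_real ((norm w)\<^sup>2)) = of_real ((norm w)\<^sup>2) * (c * (quad A v - z))"
        by (simp add: algebra_simps)
      then have "Re (c * (quad A w - z * of_real ((norm w)\<^sup>2))) = (norm w)\<^sup>2 * Re (c * (quad A v - z))"
        by (simp only: Re_of_real_times)
      moreover have "quad A v \<in> numrange A {u}" using v(1,2) by (rule numrangeI)
      then have "inner a (quad A v - z) > 0" using ab by (force simp: inner_diff_right)
      then have "Re (c * (quad A v - z)) \<ge> 0" by (simp only: c) simp
      ultimately show ?thesis by (simp only: zero_le_mult_iff zero_le_power2) simp
    qed
  qed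
qed

text \<open>
A boundary point is a limit of points outside the core.  Their hyperplanes and separating directions
have a common limit point by compactness of the unit spheres, and in the limit the form is still
semidefinite on a hyperplane.  At the same time the boundary point belongs to the core, so the form
is not definite there: this is what makes boundary points better than interior ones.
\<close>

lemma boundary_point_semidefinite:
  fixes A :: "complex^'n^'n"
  assumes "CARD('n) \<ge> 4"
  obtains l c u where "l \<in> hyperplane_core A" "c \<noteq> 0"
    "\<And>w. w \<in> cperp {u} \<Longrightarrow> 0 \<le> Re (c * quad (A - Finite_Cartesian_Product.mat l) w)"
proof -
  have "hyperplane_core A \<noteq> UNIV"
    using compact_hyperplane_core[of A] compact_imp_bounded not_bounded_UNIV by metis
  then have "frontier (hyperplane_core A) \<noteq> {}"
    using hyperplane_core_nonempty[OF assms] frontier_not_empty by blast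
  then obtain l where l: "l \<in> closure (hyperplane_core A)" "l \<in> closure (- hyperplane_core A)"
    by (auto simp: frontier_closures)
  then have lin: "l \<in> hyperplane_core A"
    using compact_imp_closed[OF compact_hyperplane_core[of A]] by simp
  obtain z where z: "\<And>k. z k \<notin> hyperplane_core A" "z \<longlonglongrightarrow> l"
    using l(2) unfolding closure_sequential by auto
  have "\<exists>p. norm (fst p) = 1 \<and> cmod (snd p) = 1 \<and>
     (\<forall>w\<in>cperp {fst p}. 0 \<le> Re (snd p * (quad A w - z k * of_real ((norm w)\<^sup>2))))" for k
  proof -
    have "2 \<le> CARD('n)" using assms by simp
    from separating_direction[OF z(1)[of k] this] show ?thesis by (metis fst_conv snd_conv)
  qed
  then obtain p where p: "\<And>k. norm (fst (p k)) = 1" "\<And>k. cmod (snd (p k)) = 1"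
     "\<And>k w. w \<in> cperp {fst (p k)} \<Longrightarrow> 0 \<le> Re (snd (p k) * (quad A w - z k * of_real ((norm w)\<^sup>2)))"
    by metis
  have "compact (sphere (0::complex^'n) 1 \<times> sphere (0::complex) 1)"
    by (intro compact_Times) auto
  moreover have "\<forall>k. p k \<in> sphere 0 1 \<times> sphere 0 1"
    using p by (auto simp: mem_Times_iff)
  ultimately obtain q r where q: "q \<in> sphere 0 1 \<times> sphere 0 1" and r: "strict_mono r" "(p \<circ> r) \<longlonglongrightarrow> q"
    unfolding compact_def by meson
  define u where "u = fst q"
  define c where "c = snd q"
  define U where "U = (\<lambda>k. fst (p (r k)))"
  define C where "C = (\<lambda>k. snd (p (r k)))"
  define Z where "Z = (\<lambda>k. z (r k))"
  have lims: "U \<longlonglongrightarrow> u" "C \<longlonglongrightarrow> c" "Z \<longlonglongrightarrow> l"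
    using tendsto_fst[OF r(2)] tendsto_snd[OF r(2)] LIMSEQ_subseq_LIMSEQ[OF z(2) r(1)]
    by (simp_all add: U_def C_def Z_def u_def c_def comp_def)
  show ?thesis
  proof (rule that[OF lin])
    show "c \<noteq> 0" using q by (auto simp: c_def)
    fix w assume w: "w \<in> cperp {u}"
    \<comment> \<open>Project the given vector of the limit hyperplane into the approximating hyperplanes.\<close>
    define W where "W k = w - cinner (U k) w *s U k" for k
    have "W \<longlonglongrightarrow> w - cinner u w *s u"
      unfolding W_def by (intro tendsto_intros lims)
    then have "W \<longlonglongrightarrow> w" using w by (simp add: cperp_def)
    then have "(\<lambda>k. Re (C k * (quad A (W k) - Z k * of_real ((norm (W k))\<^sup>2))))
        \<longlonglongrightarrow> Re (c * (quad A w - l * of_real ((norm w)\<^sup>2)))"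
      by (intro tendsto_intros lims)
    moreover have "0 \<le> Re (C k * (quad A (W k) - Z k * of_real ((norm (W k))\<^sup>2)))" for k
    proof -
      have "W k \<in> cperp {U k}"
        using p(1)[of "r k"] by (simp add: W_def cperp_def cinner_simps cinner_self U_def)
      then show ?thesis using p(3)[of "W k" "r k"] by (simp add: U_def C_def Z_def)
    qed
    ultimately have "0 \<le> Re (c * (quad A w - l * of_real ((norm w)\<^sup>2)))"
      by (intro LIMSEQ_le_const) auto
    then show "0 \<le> Re (c * quad (A - Finite_Cartesian_Product.mat l) w)"
      by (simp only: quad_diff_mat)
  qed
qed

section \<open>Hermitian forms and their kernels\<close>

locale hermitian_form =
  fixes h :: "complex^'n \<Rightarrow> complex^'n \<Rightarrow> complex"
  assumes cnj_form: "cnj (h x y) = h y x"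
    and add_right: "h x (y + z) = h x y + h x z"
    and scale_right: "h x (c *s y) = c * h x y"
begin

lemma add_left: "h (x + y) z = h x z + h y z"
  by (metis add_right cnj_form complex_cnj_add)

lemma scale_left: "h (c *s x) y = cnj c * h x y"
  by (metis scale_right cnj_form complex_cnj_mult)

lemmas form_simps = add_right add_left scale_right scale_left

lemma zero_sym: "h x y = 0 \<longleftrightarrow> h y x = 0"
  by (metis cnj_form complex_cnj_zero_iff)

text \<open>
The equality case of the Cauchy--Schwarz inequality for a semidefinite form: moving from
\<^term>\<open>w\<close> a little in the direction of \<^term>\<open>y\<close> would otherwise make the form negative.
\<close>

lemma null_vector_of_semidefinite:
  assumes psd: "\<And>w. w \<in> cperp U \<Longrightarrow> 0 \<le> Re (h w w)"
    and w: "w \<in> cperp U" "h w w = 0" and y: "y \<in> cperp U"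
  shows "h y w = 0"
proof (rule ccontr)
  assume nz: "h y w \<noteq> 0"
  define a where "a = h y w"
  define s where "s = Re (h y y)"
  \<comment> \<open>A step length for which the linear gain beats the quadratic loss.\<close>
  define t where "t = 1 / (s + 1)"
  have s: "s \<ge> 0" unfolding s_def by (rule psd[OF y])
  have hwy: "h w y = cnj a" by (simp add: a_def cnj_form)
  have "Im (h y y) = 0" using arg_cong[OF cnj_form[of y y], of Im] by simp
  then have hyy: "h y y = of_real s" by (simp add: s_def complex_eq_iff)
  let ?v = "w + (- (of_real t * a)) *s y"
  have aa: "a * cnj a = of_real ((cmod a)\<^sup>2)" by (simp only: complex_norm_square)
  have "h ?v ?v = - (2 * of_real t * (a * cnj a)) + of_real t * of_real t * (a * cnj a) * of_real s"
    unfolding form_simps w(2) hwy hyy a_def[symmetric] by (simp add: algebra_simps)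
  also have "\<dots> = of_real (t * (cmod a)\<^sup>2 * (t * s - 2))"
    unfolding aa by (simp add: algebra_simps)
  finally have "Re (h ?v ?v) = t * (cmod a)\<^sup>2 * (t * s - 2)" by simp
  moreover have "0 \<le> Re (h ?v ?v)" by (intro psd cperp_add cperp_scale w y)
  moreover have "t > 0" "t * s < 2" using s by (auto simp: t_def field_simps)
  moreover have "(cmod a)\<^sup>2 > 0" using nz by (simp add: a_def)
  ultimately show False
    by (smt (verit) mult_pos_neg mult_pos_pos)
qed

end

text \<open>
The sesquilinear form of the Hermitian part of \<open>c B\<close>.
\<close>

definition hform :: "complex \<Rightarrow> complex^'n^'n \<Rightarrow> complex^'n \<Rightarrow> complex^'n \<Rightarrow> complex" where
  "hform c B x y = (c * cinner x (B *v y) + cnj (c * cinner y (B *v x))) / 2"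

lemma hform_self: "hform c B x x = of_real (Re (c * quad B x))"
  by (simp add: hform_def quad_def complex_eq_iff)

interpretation hform: hermitian_form "hform c B"
  by unfold_locales
    (simp_all add: hform_def cinner_simps vector_scalar_commute matrix_vector_right_distrib algebra_simps add_divide_distrib)

text \<open>
A minimiser \<^term>\<open>u\<close> of the form on the unit sphere is a null vector of the semidefinite form that
results from subtracting the minimum, so it belongs to the kernel of that form; this is the eigenvector equation.
\<close>

lemma bottom_eigenvector:
  fixes B :: "complex^'n^'n"
  obtains u \<mu> where "norm u = 1" "\<And>v. \<mu> * (norm v)\<^sup>2 \<le> Re (c * quad B v)"
    "\<And>y. hform c B y u = of_real \<mu> * cinner y u"
proof -
  have "continuous_on (sphere 0 1) (\<lambda>v. Re (c * quad B v))"
    by (intro continuous_intros continuous_on_quad)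
  moreover have "sphere (0::complex^'n) 1 \<noteq> {}"
    by simp
  ultimately obtain u :: "complex^'n" where u: "norm u = 1"
    and inf: "\<And>v. norm v = 1 \<Longrightarrow> Re (c * quad B u) \<le> Re (c * quad B v)"
    using continuous_attains_inf[of "sphere 0 1" "\<lambda>v. Re (c * quad B v)"] by auto
  define \<mu> where "\<mu> = Re (c * quad B u)"
  have bound: "\<mu> * (norm v)\<^sup>2 \<le> Re (c * quad B v)" for v
  proof (cases "v = 0")
    case True
    then show ?thesis by (simp add: quad_zero)
  next
    case False
    have "v \<in> cperp {}" by (simp add: cperp_def)
    then obtain w where w: "norm w = 1" "quad B v = of_real ((norm v)\<^sup>2) * quad B w"
      using normalize_in_cperp[OF _ False] by metis
    then have "c * quad B v = of_real ((norm v)\<^sup>2) * (c * quad B w)" by (simp only: ac_simps)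
    then have "Re (c * quad B v) = (norm v)\<^sup>2 * Re (c * quad B w)"
      by (simp only: Re_of_real_times)
    then show ?thesis using inf[OF w(1)] by (simp add: \<mu>_def mult.commute mult_left_mono)
  qed
  interpret shift: hermitian_form "\<lambda>x y. hform c B x y - of_real \<mu> * cinner x y"
    by unfold_locales (simp_all add: hform.form_simps hform.cnj_form cinner_simps cnj_cinner algebra_simps)
  have "hform c B y u - of_real \<mu> * cinner y u = 0" for y
  proof (rule shift.null_vector_of_semidefinite[where U = "{}"])
    show "0 \<le> Re (hform c B w w - of_real \<mu> * cinner w w)" for w
      using bound[of w] by (simp add: hform_self cinner_self)
    show "hform c B u u - of_real \<mu> * cinner u u = 0"
      by (simp add: hform_self cinner_self u \<mu>_def)
  qed (simp_all add: cperp_def)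
  then show ?thesis using that[OF u bound] by simp
qed

text \<open>
On an arbitrary hyperplane where the form is semidefinite, a null vector is only orthogonal to that
hyperplane.  The hyperplane can be exchanged for one that is invariant, namely the complement of
a bottom eigenvector, and there null vectors lie in the kernel of the form on the whole space.
\<close>

lemma semidefinite_on_eigenvector_complement:
  assumes psd: "\<And>w. w \<in> cperp {a} \<Longrightarrow> 0 \<le> Re (c * quad B w)"
  obtains u where "norm u = 1" "\<And>w. w \<in> cperp {u} \<Longrightarrow> 0 \<le> Re (c * quad B w)"
    "\<And>w y. w \<in> cperp {u} \<Longrightarrow> Re (c * quad B w) = 0 \<Longrightarrow> hform c B w y = 0"
proof -
  obtain u \<mu> where u: "norm u = 1" and bound: "\<And>v. \<mu> * (norm v)\<^sup>2 \<le> Re (c * quad B v)"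
    and eig: "\<And>y. hform c B y u = of_real \<mu> * cinner y u"
    using bottom_eigenvector[of c B] by metis
  \<comment> \<open>The eigenvector is orthogonal to its complement also with respect to the form.\<close>
  have hwu: "hform c B w u = 0" "hform c B u w = 0" if "w \<in> cperp {u}" for w
    using that eig[of w] hform.zero_sym[of c B w u] cinner_commute_zero[of w u]
    by (auto simp: cperp_def)
  have pos: "0 \<le> Re (c * quad B w)" if w: "w \<in> cperp {u}" for w
  proof (rule ccontr)
    assume neg: "\<not> 0 \<le> Re (c * quad B w)"
    then have w0: "w \<noteq> 0" by (auto simp: quad_zero)
    have \<mu>: "\<mu> < 0"
    proof -
      have "\<mu> * (norm w)\<^sup>2 < 0" using bound[of w] neg by linarith
      then show ?thesis using w0 by (simp add: mult_less_0_iff)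
    qed
    \<comment> \<open>Now the form is negative definite on the plane of these two vectors, which meets the
        given hyperplane nontrivially.\<close>
    obtain \<alpha> \<beta> where ab: "\<alpha> * cinner a u + \<beta> * cinner a w = 0" "\<alpha> \<noteq> 0 \<or> \<beta> \<noteq> 0"
    proof (cases "cinner a u = 0")
      case True
      then show ?thesis using that[of 1 0] by simp
    next
      case False
      then show ?thesis using that[of "- cinner a w" "cinner a u"] by simp
    qed
    let ?v = "\<alpha> *s u + \<beta> *s w"
    have uu: "hform c B u u = of_real \<mu>" by (simp add: eig cinner_self u)
    have "hform c B ?v ?v = of_real \<mu> * (\<alpha> * cnj \<alpha>) + of_real (Re (c * quad B w)) * (\<beta> * cnj \<beta>)"
      unfolding hform.form_simps hwu[OF w] uu hform_self[of c B w] by (simp add: algebra_simps)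
    also have "\<dots> = of_real (\<mu> * (cmod \<alpha>)\<^sup>2 + Re (c * quad B w) * (cmod \<beta>)\<^sup>2)"
      unfolding complex_norm_square[symmetric] by simp
    finally have "Re (c * quad B ?v) = \<mu> * (cmod \<alpha>)\<^sup>2 + Re (c * quad B w) * (cmod \<beta>)\<^sup>2"
      unfolding hform_self of_real_eq_iff .
    moreover have "\<mu> * (cmod \<alpha>)\<^sup>2 \<le> 0" "Re (c * quad B w) * (cmod \<beta>)\<^sup>2 \<le> 0"
      using \<mu> neg by (auto simp: mult_nonpos_nonneg)
    moreover have "\<mu> * (cmod \<alpha>)\<^sup>2 < 0 \<or> Re (c * quad B w) * (cmod \<beta>)\<^sup>2 < 0"
      using \<mu> neg ab(2) by (auto simp: mult_neg_pos)
    moreover have "0 \<le> Re (c * quad B ?v)"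
      by (rule psd) (simp add: cperp_def cinner_simps ab(1))
    ultimately show False by linarith
  qed
  have ker: "hform c B w y = 0" if w: "w \<in> cperp {u}" "Re (c * quad B w) = 0" for w y
  proof -
    let ?y = "y - cinner u y *s u"
    have "hform c B ?y w = 0"
    proof (rule hform.null_vector_of_semidefinite[where U = "{u}"])
      show "0 \<le> Re (hform c B v v)" if "v \<in> cperp {u}" for v
        using pos[OF that] by (simp add: hform_self)
      show "?y \<in> cperp {u}" by (simp add: cperp_def cinner_simps cinner_self u)
    qed (use w in \<open>auto simp: hform_self\<close>)
    then have "hform c B w ?y = 0" by (simp only: hform.zero_sym)
    moreover have "hform c B w y = hform c B w ?y + cinner u y * hform c B w u"
      by (simp flip: hform.form_simps)
    ultimately show ?thesis by (simp add: hwu[OF w(1)])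
  qed
  show ?thesis using that u pos ker by blast
qed

lemma riesz_vector:
  fixes f :: "complex^'n \<Rightarrow> complex"
  assumes "\<And>x y. f (x + y) = f x + f y" "\<And>c x. f (c *s x) = c * f x"
  obtains h where "\<And>y. f y = cinner h y"
proof
  fix y
  have f0: "f 0 = 0" using assms(2)[of 0 0] by simp
  have "f (\<Sum>i\<in>S. (y$i) *s axis i 1) = (\<Sum>i\<in>S. y$i * f (axis i 1))" if "finite S" for S
    using that by (induction S) (auto simp: f0 assms)
  from this[of UNIV] show "f y = cinner (\<chi> i. cnj (f (axis i 1))) y"
    by (simp add: basis_expansion cinner_def mult.commute)
qed

section \<open>Totally isotropic planes\<close>

text \<open>
If \<^term>\<open>B\<close> has an isotropic vector in every hyperplane, take one in the invariant hyperplane just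
constructed: being a null vector of the semidefinite Hermitian part, it lies in the kernel.
\<close>

lemma isotropic_kernel_vector:
  assumes iso: "\<And>u. norm u = 1 \<Longrightarrow> \<exists>w\<in>cperp {u}. w \<noteq> 0 \<and> quad B w = 0"
    and psd: "\<And>w. w \<in> cperp {a} \<Longrightarrow> 0 \<le> Re (c * quad B w)"
  obtains k where "k \<noteq> 0" "quad B k = 0" "\<And>y. hform c B k y = 0"
proof -
  obtain u where u: "norm u = 1"
    "\<And>w y. w \<in> cperp {u} \<Longrightarrow> Re (c * quad B w) = 0 \<Longrightarrow> hform c B w y = 0"
    using semidefinite_on_eigenvector_complement[OF psd] by metis
  obtain k where "k \<in> cperp {u}" "k \<noteq> 0" "quad B k = 0"
    using iso[OF u(1)] by blast
  then show ?thesis using that u(2) by simp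
qed

text \<open>
The half planes that contain \<^term>\<open>K\<close> in their interior form an open set of directions, so one can be
found whose direction is not a real multiple of \<^term>\<open>c0\<close>.
\<close>

lemma generic_separating_coefficient:
  fixes c0 :: complex
  assumes K: "compact K" "convex K" "0 \<notin> K" and c0: "c0 \<noteq> 0"
  obtains \<alpha> \<beta> where "\<beta> \<noteq> 0" "\<And>z. z \<in> K \<Longrightarrow> 0 < Re ((of_real \<alpha> * c0 + of_real \<beta> * (\<i> * c0)) * z)"
proof -
  obtain a b where ab: "0 < b" "\<And>z. z \<in> K \<Longrightarrow> b < inner a z"
    using separating_hyperplane_closed_0[OF K(2) compact_imp_closed[OF K(1)] K(3)] by blast
  obtain M where M: "M > 0" "\<And>z. z \<in> K \<Longrightarrow> cmod z \<le> M"
    using compact_imp_bounded[OF K(1)] bounded_pos by metis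
  define d where "d = cnj a / c0"
  \<comment> \<open>A rotation that is small enough not to use up the gap, applied only if it is needed.\<close>
  define \<delta> where "\<delta> = (if Im d = 0 then b / (M * cmod c0) else 0)"
  have dd: "cmod (of_real \<delta> * (\<i> * c0)) * M \<le> b"
    using M ab c0 by (simp add: \<delta>_def norm_mult)
  show ?thesis
  proof
    show "Im d + \<delta> \<noteq> 0" using ab M c0 by (auto simp: \<delta>_def)
    fix z assume z: "z \<in> K"
    have "of_real (Re d) * c0 + of_real (Im d + \<delta>) * (\<i> * c0)
        = (of_real (Re d) + \<i> * of_real (Im d)) * c0 + of_real \<delta> * (\<i> * c0)"
      by (simp add: algebra_simps)
    also have "\<dots> = cnj a + of_real \<delta> * (\<i> * c0)"
      using c0 by (simp only: complex_eq[symmetric]) (simp add: d_def)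
    finally have comb: "of_real (Re d) * c0 + of_real (Im d + \<delta>) * (\<i> * c0)
        = cnj a + of_real \<delta> * (\<i> * c0)" .
    have eq: "(of_real (Re d) * c0 + of_real (Im d + \<delta>) * (\<i> * c0)) * z
       = cnj a * z + (of_real \<delta> * (\<i> * c0)) * z"
      unfolding comb by (rule distrib_right)
    have "\<bar>Re ((of_real \<delta> * (\<i> * c0)) * z)\<bar> \<le> cmod ((of_real \<delta> * (\<i> * c0)) * z)"
      by (rule abs_Re_le_cmod)
    also have "\<dots> \<le> cmod (of_real \<delta> * (\<i> * c0)) * M"
      unfolding norm_mult[of _ z] by (intro mult_left_mono M(2) z) simp
    also have "\<dots> \<le> b" by (rule dd)
    finally have "\<bar>Re ((of_real \<delta> * (\<i> * c0)) * z)\<bar> \<le> b" .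
    moreover have "Re (cnj a * z) > b" using ab(2)[OF z] by (simp add: inner_complex_def)
    ultimately show "0 < Re ((of_real (Re d) * c0 + of_real (Im d + \<delta>) * (\<i> * c0)) * z)"
      unfolding eq by simp
  qed
qed

lemma hform_combination:
  "hform (of_real \<alpha> * c + of_real \<beta> * d) B x y = of_real \<alpha> * hform c B x y + of_real \<beta> * hform d B x y"
  by (simp add: hform_def algebra_simps add_divide_distrib)

text \<open>
Let \<^term>\<open>x\<close> be an isotropic vector in the kernel of the Hermitian part of \<open>c0 B\<close>.  The vectors
\<^term>\<open>y\<close> that are orthogonal to \<^term>\<open>x\<close> with respect to \<^term>\<open>B\<close> on both sides are then given by
a single further equation, \<^prop>\<open>cinner h y = 0\<close>, where \<^term>\<open>h\<close> represents the other
Hermitian part at \<^term>\<open>x\<close>.  An isotropic vector of \<^term>\<open>B\<close> is wanted among those that are also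
perpendicular to \<^term>\<open>x\<close>.

Suppose that there is none.  Then \<^term>\<open>h\<close> is not 0, as otherwise an isotropic vector in the hyperplane
perpendicular to \<^term>\<open>x\<close> would do.  By convexity of the numerical range the Hermitian part of some
\<open>c B\<close>, with \<^term>\<open>c\<close> not a real multiple of \<^term>\<open>c0\<close>, is positive definite on \<^term>\<open>cperp {x, h}\<close>, hence semidefinite on the hyperplane
\<^term>\<open>cperp {h}\<close> with null vectors only in the line of \<^term>\<open>x\<close>.  So it has a kernel vector
\<^term>\<open>k\<close> that is isotropic for \<^term>\<open>B\<close>.  Pairing it with \<^term>\<open>x\<close> shows that \<^term>\<open>k\<close> is in
\<^term>\<open>cperp {h}\<close>, hence a multiple of \<^term>\<open>x\<close>; but \<^term>\<open>x\<close> is not in the kernel because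
it pairs nontrivially with \<^term>\<open>h\<close>.
\<close>

lemma isotropic_plane:
  fixes B :: "complex^'n^'n"
  assumes n: "CARD('n) \<ge> 3"
    and iso: "\<And>u. norm u = 1 \<Longrightarrow> \<exists>w\<in>cperp {u}. w \<noteq> 0 \<and> quad B w = 0"
    and c0: "c0 \<noteq> 0" and psd: "\<And>w. w \<in> cperp {a} \<Longrightarrow> 0 \<le> Re (c0 * quad B w)"
  obtains x y where "x \<noteq> 0" "y \<noteq> 0" "cinner x y = 0" "quad B x = 0" "quad B y = 0"
    "cinner x (B *v y) = 0" "cinner y (B *v x) = 0"
proof -
  obtain x where x: "x \<noteq> 0" "quad B x = 0" and Px: "\<And>y. hform c0 B x y = 0"
    using isotropic_kernel_vector[OF iso psd] by metis
  obtain h where h: "\<And>y. hform (\<i> * c0) B x y = cinner h y"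
    by (rule riesz_vector[of "hform (\<i> * c0) B x"]) (simp_all add: hform.form_simps)
  have hx: "cinner h x = 0" using h[of x] by (simp add: hform_self x(2))
  have "\<exists>y\<in>cperp {x, h}. y \<noteq> 0 \<and> quad B y = 0"
  proof (rule ccontr)
    assume none: "\<not> ?thesis"
    have "h \<noteq> 0"
    proof
      assume "h = 0"
      obtain w where "w \<in> cperp {(1 / norm x) *\<^sub>R x}" "w \<noteq> 0" "quad B w = 0"
        using iso[of "(1 / norm x) *\<^sub>R x"] x by auto
      then have "w \<in> cperp {x, h}" "w \<noteq> 0" "quad B w = 0"
        using \<open>h = 0\<close> x by (auto simp: cperp_def cinner_simps scaleR_eq_scale)
      then show False using none by blast
    qed
    have "0 \<notin> numrange B {x, h}"
    proof
      assume "0 \<in> numrange B {x, h}"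
      then obtain w where "w \<in> cperp {x, h}" "norm w = 1" "quad B w = 0"
        by (auto simp: numrange_def)
      then show False using none by force
    qed
    \<comment> \<open>A nonzero component along \<open>\<i> * c0\<close> keeps the new Hermitian part from annihilating x.\<close>
    then obtain \<alpha> \<beta> where \<beta>: "\<beta> \<noteq> 0"
      and sep: "\<And>z. z \<in> numrange B {x, h} \<Longrightarrow> 0 < Re ((of_real \<alpha> * c0 + of_real \<beta> * (\<i> * c0)) * z)"
      using generic_separating_coefficient[OF compact_numrange convex_numrange _ c0] by metis
    define c where "c = of_real \<alpha> * c0 + of_real \<beta> * (\<i> * c0)"
    have Fx: "hform c B x y = of_real \<beta> * cinner h y" for y
      by (simp only: c_def hform_combination Px h) simp
    have pos: "0 < Re (c * quad B v)" if v: "v \<in> cperp {x, h}" "v \<noteq> 0" for v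
    proof -
      obtain w where w: "w \<in> cperp {x, h}" "norm w = 1" "quad B v = of_real ((norm v)\<^sup>2) * quad B w"
        using normalize_in_cperp[OF v] by metis
      have "0 < Re (c * quad B w)" unfolding c_def by (intro sep numrangeI w)
      moreover have "c * quad B v = of_real ((norm v)\<^sup>2) * (c * quad B w)"
        by (simp only: w(3) ac_simps)
      then have "Re (c * quad B v) = (norm v)\<^sup>2 * Re (c * quad B w)"
        by (simp only: Re_of_real_times)
      ultimately show ?thesis using v by simp
    qed
    \<comment> \<open>The line of x does not contribute to the form on the hyperplane orthogonal to h.\<close>
    have split: "\<exists>s v. w = s *s x + v \<and> v \<in> cperp {x, h} \<and> Re (c * quad B w) = Re (c * quad B v)"
      if w: "w \<in> cperp {h}" for w
    proof (intro exI conjI)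
      let ?s = "cinner x w / of_real ((norm x)\<^sup>2)"
      let ?v = "w - ?s *s x"
      show dec: "w = ?s *s x + ?v" by simp
      show v: "?v \<in> cperp {x, h}"
        using w x(1) hx by (simp add: cperp_def cinner_simps cinner_self)
      have hv: "cinner h ?v = 0" using v by (simp add: cperp_def)
      have "hform c B w w = hform c B (?s *s x + ?v) (?s *s x + ?v)" by simp
      also have "\<dots> = hform c B ?v ?v"
        unfolding hform.form_simps Fx hv hx hform.cnj_form[of c B x ?v, symmetric] by simp
      finally show "Re (c * quad B w) = Re (c * quad B ?v)"
        unfolding hform_self of_real_eq_iff .
    qed
    have "0 \<le> Re (c * quad B w)" if "w \<in> cperp {h}" for w
      using split[OF that] pos by (metis less_eq_real_def mult_zero_right quad_zero zero_complex.simps(1))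
    then obtain k where k: "k \<noteq> 0" "quad B k = 0" "\<And>y. hform c B k y = 0"
      using isotropic_kernel_vector[OF iso, of h c] by metis
    have "of_real \<beta> * cinner h k = 0"
      using k(3)[of x] Fx[of k] hform.zero_sym[of c B k x] by metis
    then have "k \<in> cperp {h}" using \<beta> by (simp add: cperp_def)
    then obtain s v where sv: "k = s *s x + v" "v \<in> cperp {x, h}" "Re (c * quad B k) = Re (c * quad B v)"
      using split by blast
    then have "v = 0" using pos[of v] k(2) by force
    then have "k = s *s x" "s \<noteq> 0" using sv k(1) by auto
    then have "hform c B x h = 0" using k(3)[of h] by (simp add: hform.form_simps)
    then show False using \<beta> \<open>h \<noteq> 0\<close> by (simp add: Fx cinner_self)
  qed
  then obtain y where y: "y \<in> cperp {x, h}" "y \<noteq> 0" "quad B y = 0" by blast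
  \<comment> \<open>Both Hermitian parts vanish at this pair, hence so do both values of B.\<close>
  have "hform c0 B x y = 0" "hform (\<i> * c0) B x y = 0"
    using y(1) by (simp_all add: Px h cperp_def)
  then have "c0 * cinner x (B *v y) + cnj (c0 * cinner y (B *v x)) = 0"
    "\<i> * (c0 * cinner x (B *v y) - cnj (c0 * cinner y (B *v x))) = 0"
    by (simp_all add: hform_def algebra_simps)
  then have "c0 * cinner x (B *v y) = 0" "cnj (c0 * cinner y (B *v x)) = 0"
    by (auto simp: add_eq_0_iff)
  then show ?thesis using that[of x y] x y c0 by (simp add: cperp_def)
qed

text \<open>
For a boundary point \<^term>\<open>l\<close> of the core, the matrix \<^term>\<open>A - Finite_Cartesian_Product.mat l\<close> has
isotropic vectors in all hyperplanes and a Hermitian part that is semidefinite on one of them, so it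
has a totally isotropic plane.  An orthonormal basis of that plane does what is claimed.
\<close>

theorem scalar_two_dimensional_compression:
  fixes A :: "complex^'n^'n"
  assumes "CARD('n) \<ge> 4"
  obtains l x y where "cinner x x = 1" "cinner y y = 1" "cinner x y = 0"
    "cinner x (A *v x) = l" "cinner y (A *v y) = l"
    "cinner x (A *v y) = 0" "cinner y (A *v x) = 0"
proof -
  obtain l c a where l: "l \<in> hyperplane_core A" and c: "c \<noteq> 0"
    and psd: "\<And>w. w \<in> cperp {a} \<Longrightarrow> 0 \<le> Re (c * quad (A - Finite_Cartesian_Product.mat l) w)"
    using boundary_point_semidefinite[OF assms] by metis
  let ?B = "A - Finite_Cartesian_Product.mat l"
  have iso: "\<exists>w\<in>cperp {u}. w \<noteq> 0 \<and> quad ?B w = 0" if "norm u = 1" for u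
  proof -
    have "l \<in> numrange A {u}" using l that by (auto simp: hyperplane_core_def)
    then obtain w where "w \<in> cperp {u}" "norm w = 1" "quad A w = l"
      by (auto simp: numrange_def)
    then show ?thesis by (intro bexI[of _ w]) (auto simp: quad_diff_mat)
  qed
  have "CARD('n) \<ge> 3" using assms by simp
  then obtain x y where xy: "x \<noteq> 0" "y \<noteq> 0" "cinner x y = 0" "quad ?B x = 0" "quad ?B y = 0"
    "cinner x (?B *v y) = 0" "cinner y (?B *v x) = 0"
    using isotropic_plane[OF _ iso c psd] by metis
  have yx: "cinner y x = 0" using xy(3) by (simp only: cinner_commute_zero)
  have "cinner x (A *v x) = l * cinner x x" "cinner y (A *v y) = l * cinner y y"
    "cinner x (A *v y) = 0" "cinner y (A *v x) = 0"
    using xy(4-7) by (simp_all add: quad_def xy(3) yx cinner_diff_mat)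
  moreover have "cinner x x \<noteq> 0" "cinner y y \<noteq> 0" using xy(1,2) by (simp_all add: cinner_self)
  moreover define x' where "x' = of_real (1 / norm x) *s x"
  moreover define y' where "y' = of_real (1 / norm y) *s y"
  ultimately show ?thesis
    using xy(1,2)
    by (intro that[of x' y' l])
      (simp_all add: cinner_simps vector_scalar_commute xy(3) cinner_self[of x] cinner_self[of y]
        power2_eq_square)
qed

section \<open>Compression of a matrix of arbitrary size\<close>

lemma sum_supported_on_range:
  fixes f :: "'n::finite \<Rightarrow> nat"
  assumes f: "inj f" "range f \<subseteq> {0..<n}"
  shows "(\<Sum>i = 0..<n. if i \<in> range f then F (inv_into UNIV f i) else (0::'a::comm_monoid_add)) = (\<Sum>k\<in>UNIV. F k)"
proof -
  have "(\<Sum>i = 0..<n. if i \<in> range f then F (inv_into UNIV f i) else 0) = (\<Sum>i\<in>range f. F (inv_into UNIV f i))"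
    by (intro sum.mono_neutral_cong_right) (use f in auto)
  also have "\<dots> = (\<Sum>k\<in>UNIV. F k)"
    using f(1) by (simp add: sum.reindex)
  finally show ?thesis .
qed

text \<open>
A principal submatrix of size 4 has a scalar compression to a plane by the preceding theorem.
Padding the two basis vectors with zeros gives a compression of the whole matrix to the same
scalar matrix.
\<close>

theorem corollary2:
  fixes A :: "complex mat" and n :: nat
  assumes "n \<ge> 4"
    and "A \<in> carrier_mat n n"
  shows "rank_numerical_range 2 A \<noteq> {}"
proof -
  obtain b where b: "bij_betw b (UNIV :: 4 set) {0..<4::nat}"
    using ex_bij_betw_finite_nat[of "UNIV :: 4 set"] by auto
  then have f: "inj b" "range b \<subseteq> {0..<n}"
    using assms(1) by (auto simp: bij_betw_def)
  define M :: "complex^4^4" where "M = (\<chi> i j. A $$ (b i, b j))"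
  obtain l x y where xy: "cinner x x = 1" "cinner y y = 1" "cinner x y = 0"
    "cinner x (M *v x) = l" "cinner y (M *v y) = l"
    "cinner x (M *v y) = 0" "cinner y (M *v x) = 0"
    by (rule scalar_two_dimensional_compression[of M]) simp_all
  have yx: "cinner y x = 0" using xy(3) by (simp only: cinner_commute_zero)
  define v where "v j = (if j = (0::nat) then x else y)" for j
  \<comment> \<open>The columns of the isometry: the two vectors, extended by 0 outside the chosen four rows.\<close>
  define e where "e j i = (if i \<in> range b then v j $ inv_into UNIV b i else 0)" for j i
  define X where "X = Matrix.mat n 2 (\<lambda>(i, j). e j i)"
  have X: "X \<in> carrier_mat n 2" by (simp add: X_def)
  have gram: "(\<Sum>i = 0..<n. cnj (e p i) * e q i) = cinner (v p) (v q)" for p q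
    unfolding cinner_def sum_supported_on_range[OF f, symmetric]
    by (intro sum.cong) (auto simp: e_def)
  have compr: "(\<Sum>j = 0..<n. (\<Sum>i = 0..<n. cnj (e p i) * A $$ (i, j)) * e q j) = cinner (v p) (M *v v q)" for p q
  proof -
    have "(\<Sum>j = 0..<n. (\<Sum>i = 0..<n. cnj (e p i) * A $$ (i, j)) * e q j)
      = (\<Sum>j = 0..<n. if j \<in> range b
          then (\<Sum>i = 0..<n. if i \<in> range b then cnj (v p $ inv_into UNIV b i) * A $$ (b (inv_into UNIV b i), b (inv_into UNIV b j)) else 0) * v q $ inv_into UNIV b j
          else 0)"
      by (intro sum.cong refl) (auto simp: e_def f_inv_into_f intro!: sum.cong arg_cong2[where f = "(*)"])
    also have "\<dots> = (\<Sum>l\<in>UNIV. (\<Sum>k\<in>UNIV. cnj (v p $ k) * A $$ (b k, b l)) * v q $ l)"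
      by (simp only: sum_supported_on_range[OF f, where F = "\<lambda>k. cnj (v p $ k) * A $$ (b k, c)" for c]
          sum_supported_on_range[OF f, where F = "\<lambda>l. (\<Sum>k\<in>UNIV. cnj (v p $ k) * A $$ (b k, b l)) * v q $ l"])
    also have "\<dots> = (\<Sum>k\<in>UNIV. \<Sum>l\<in>UNIV. cnj (v p $ k) * A $$ (b k, b l) * v q $ l)"
      unfolding sum_distrib_right by (rule sum.swap)
    also have "\<dots> = cinner (v p) (M *v v q)"
      by (simp add: cinner_def matrix_vector_mult_def M_def sum_distrib_left mult.assoc)
    finally show ?thesis .
  qed
  have adj: "mat_adjoint X = Matrix.mat 2 n (\<lambda>(i, j). cnj (e i j))"
    by (auto simp: mat_adjoint_complex X_def intro!: eq_matI)
  have G: "mat_adjoint X * X = Matrix.mat 2 2 (\<lambda>(p, q). cinner (v p) (v q))"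
    unfolding adj by (rule eq_matI) (simp_all add: X_def scalar_prod_def gram)
  have C: "mat_adjoint X * A * X = Matrix.mat 2 2 (\<lambda>(p, q). cinner (v p) (M *v v q))"
  proof (rule eq_matI)
    fix p q assume "p < dim_row (Matrix.mat 2 2 (\<lambda>(p, q). cinner (v p) (M *v v q)))"
      "q < dim_col (Matrix.mat 2 2 (\<lambda>(p, q). cinner (v p) (M *v v q)))"
    then have "(mat_adjoint X * A * X) $$ (p, q) = (\<Sum>j = 0..<n. (\<Sum>i = 0..<n. cnj (e p i) * A $$ (i, j)) * e q j)"
      using assms(2) unfolding adj by (simp add: X_def scalar_prod_def)
    then show "(mat_adjoint X * A * X) $$ (p, q) = Matrix.mat 2 2 (\<lambda>(p, q). cinner (v p) (M *v v q)) $$ (p, q)"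
      using \<open>p < _\<close> \<open>q < _\<close> by (simp add: compr)
  qed (simp_all add: adj, simp add: X_def)
  have "mat_adjoint X * X = 1\<^sub>m 2" "mat_adjoint X * A * X = l \<cdot>\<^sub>m 1\<^sub>m 2"
    unfolding G C by (auto simp: v_def xy yx less_2_cases_iff intro!: eq_matI)
  then have "l \<in> rank_numerical_range 2 A"
    using X assms(2) by (auto simp: rank_numerical_range_def)
  then show ?thesis by blast
qed

end
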